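(* Let $G=(V,E)$ be a locally finite connected simple graph with Bernoulli bond percolation in which each edge $e\in E$ is open with probability $p_e\in[0,1]$, independently of the other edges. Let $a,b,c$ be distinct vertices of $G$. Then $$\mathbf{P}(abc)^2\le 8\,\mathbf{P}(ab)\,\mathbf{P}(ac)\,\mathbf{P}(bc)$$ and $$\mathbf{P}(abc)^2\le 2\,\mathbf{P}(ab\cup ac)^2\,\mathbf{P}(bc).$$
   Context: $\mathbf{P}$ is the product measure on $\{0,1\}^E$ in which edge $e$ is open with probability $p_e$. Clusters are the connected components of the subgraph of open edges. $abc$ is the event that $a,b,c$ are all in the same cluster; for vertices $u,v$, $uv$ is the event that $u$ and $v$ are in the same cluster; $ab\cup ac$ is the union of the events $ab$ and $ac$. *)

theory Defs
  imports "HOL-Probability.Probability"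
begin

text \<open>A graph is given by its vertex set and its set of edges, each edge being the unordered pair
  of its endpoints. Vertex and edge sets may be infinite.\<close>

definition simple_graph :: "'v set \<Rightarrow> 'v set set \<Rightarrow> bool" where
  "simple_graph V E \<longleftrightarrow> (\<forall>e\<in>E. e \<subseteq> V \<and> card e = 2)"

definition locally_finite_graph :: "'v set \<Rightarrow> 'v set set \<Rightarrow> bool" where
  "locally_finite_graph V E \<longleftrightarrow> (\<forall>v\<in>V. finite {e \<in> E. v \<in> e})"

definition adj :: "'v set set \<Rightarrow> ('v \<times> 'v) set" where
  "adj E = {(u, v). {u, v} \<in> E}"

definition connection :: "'v set \<Rightarrow> 'v set set \<Rightarrow> ('v \<times> 'v) set" where
  "connection V E = (adj E)\<^sup>* \<inter> V \<times> V"

definition connected_graph :: "'v set \<Rightarrow> 'v set set \<Rightarrow> bool" where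
  "connected_graph V E \<longleftrightarrow> (\<forall>u\<in>V. \<forall>v\<in>V. (u, v) \<in> connection V E)"

definition graph_components :: "'v set \<Rightarrow> 'v set set \<Rightarrow> 'v set set" where
  "graph_components V E = V // connection V E"

text \<open>A configuration assigns a truth value to each edge: \<open>True\<close> means open, \<open>False\<close> means closed.\<close>

definition percolation :: "'v set set \<Rightarrow> ('v set \<Rightarrow> real) \<Rightarrow> ('v set \<Rightarrow> bool) measure" where
  "percolation E p = (\<Pi>\<^sub>M e\<in>E. measure_pmf (bernoulli_pmf (p e)))"

definition open_edges :: "'v set set \<Rightarrow> ('v set \<Rightarrow> bool) \<Rightarrow> 'v set set" where
  "open_edges E \<omega> = {e \<in> E. \<omega> e}"

text \<open>Closed edges are deleted but all vertices are kept, so isolated vertices form clusters.\<close>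

definition clusters :: "'v set \<Rightarrow> 'v set set \<Rightarrow> ('v set \<Rightarrow> bool) \<Rightarrow> 'v set set" where
  "clusters V E \<omega> = graph_components V (open_edges E \<omega>)"

definition same_cluster ::
    "'v set \<Rightarrow> 'v set set \<Rightarrow> ('v set \<Rightarrow> real) \<Rightarrow> 'v set \<Rightarrow> ('v set \<Rightarrow> bool) set" where
  "same_cluster V E p S = {\<omega> \<in> space (percolation E p). \<exists>C\<in>clusters V E \<omega>. S \<subseteq> C}"

lemma prob_space_percolation: "prob_space (percolation E p)"
  unfolding percolation_def by (intro prob_space_PiM prob_space_measure_pmf)

lemma sym_adj: "sym (adj E)"
  by (auto simp: adj_def sym_def insert_commute)

lemma equiv_connection: "equiv V (connection V E)"
proof (rule equivI)
  show "refl_on V (connection V E)" by (auto simp: connection_def refl_on_def)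
  show "sym (connection V E)"
    using sym_rtrancl[OF sym_adj[of E]] by (auto simp: connection_def sym_def)
  show "trans (connection V E)"
    unfolding connection_def by (intro trans_Int trans_rtrancl) (auto intro: transI)
  show "connection V E \<subseteq> V \<times> V" by (simp add: connection_def)
qed

lemma subset_component_iff:
  assumes "a \<in> S"
  shows "(\<exists>C\<in>graph_components V E. S \<subseteq> C) \<longleftrightarrow> (\<forall>x\<in>S. (a, x) \<in> connection V E)"
proof
  assume "\<exists>C\<in>graph_components V E. S \<subseteq> C"
  then obtain C where "C \<in> V // connection V E" "S \<subseteq> C" by (auto simp: graph_components_def)
  then show "\<forall>x\<in>S. (a, x) \<in> connection V E"
    using assms quotient_eq_iff[OF equiv_connection, of C V E C a] by blast
next
  assume h: "\<forall>x\<in>S. (a, x) \<in> connection V E"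
  then have "a \<in> V" using assms by (auto simp: connection_def)
  then show "\<exists>C\<in>graph_components V E. S \<subseteq> C"
    using h by (intro bexI[of _ "connection V E `` {a}"])
      (auto simp: graph_components_def quotientI)
qed

lemma countable_vertices:
  assumes G: "simple_graph V E" "locally_finite_graph V E" "connected_graph V E"
  shows "countable V"
proof (cases "V = {}")
  case False
  then obtain a where a: "a \<in> V" by blast
  have fin: "finite ((adj E ^^ n) `` {a}) \<and> (adj E ^^ n) `` {a} \<subseteq> V" for n
  proof (induction n)
    case 0 then show ?case using a by auto
  next
    case (Suc n)
    have eq: "(adj E ^^ Suc n) `` {a} = (\<Union>w\<in>(adj E ^^ n) `` {a}. adj E `` {w})"
      by auto
    have "finite (adj E `` {w}) \<and> adj E `` {w} \<subseteq> V" if "w \<in> V" for w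
    proof -
      have sub: "adj E `` {w} \<subseteq> \<Union> {e \<in> E. w \<in> e}" by (auto simp: adj_def)
      have "finite (\<Union> {e \<in> E. w \<in> e})"
      proof (rule finite_Union)
        show "finite {e \<in> E. w \<in> e}" using G(2) that by (auto simp: locally_finite_graph_def)
        fix e assume "e \<in> {e \<in> E. w \<in> e}"
        then have "card e = 2" using G(1) by (auto simp: simple_graph_def)
        then show "finite e" using card.infinite by fastforce
      qed
      then show ?thesis using sub G(1) by (auto simp: simple_graph_def intro: finite_subset)
    qed
    then show ?case unfolding eq using Suc.IH by (auto intro!: finite_UN_I)
  qed
  have "V \<subseteq> (\<Union>n. (adj E ^^ n) `` {a})"
    using a G(3) by (auto simp: connected_graph_def connection_def simp flip: rtrancl_power)
  then show ?thesis
    by (rule countable_subset) (use fin in \<open>auto intro: countable_finite\<close>)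
qed auto

lemma sets_same_cluster:
  assumes G: "simple_graph V E" "locally_finite_graph V E" "connected_graph V E"
    and S: "finite S" "S \<noteq> {}"
  shows "same_cluster V E p S \<in> sets (percolation E p)"
proof -
  let ?M = "percolation E p"
  note cV = countable_vertices[OF G]
  have E: "Measurable.pred ?M (\<lambda>\<omega>. e \<in> open_edges E \<omega>)" for e
  proof (cases "e \<in> E")
    case True
    have "(\<lambda>\<omega>. \<omega> e) \<in> measurable ?M (measure_pmf (bernoulli_pmf (p e)))"
      unfolding percolation_def by (rule measurable_component_singleton[OF True])
    then show ?thesis using True by (simp add: open_edges_def measurable_def)
  qed (simp add: open_edges_def)
  have R: "Measurable.pred ?M (\<lambda>\<omega>. (u, v) \<in> adj (open_edges E \<omega>) ^^ n)" for u v n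
  proof (induction n arbitrary: v)
    case 0 then show ?case by simp
  next
    case (Suc n)
    have eq: "(u, v) \<in> adj (open_edges E \<omega>) ^^ Suc n \<longleftrightarrow>
        (\<exists>w\<in>V. (u, w) \<in> adj (open_edges E \<omega>) ^^ n \<and> {w, v} \<in> open_edges E \<omega>)" for \<omega>
    proof -
      have "w \<in> V" if "{w, v} \<in> open_edges E \<omega>" for w
        using G(1) that by (auto simp: open_edges_def simple_graph_def)
      then show ?thesis by (simp add: adj_def relcomp_unfold) blast
    qed
    have "Measurable.pred ?M
        (\<lambda>\<omega>. (u, w) \<in> adj (open_edges E \<omega>) ^^ n \<and> {w, v} \<in> open_edges E \<omega>)" for w
      by (intro pred_intros_logic(3) Suc.IH E)
    then show ?case unfolding eq pred_def
      by (intro sets.sets_Collect_countable_Ex' cV)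
  qed
  have C: "Measurable.pred ?M (\<lambda>\<omega>. (u, v) \<in> connection V (open_edges E \<omega>))" for u v
  proof -
    have eq: "(u, v) \<in> connection V (open_edges E \<omega>) \<longleftrightarrow>
        (\<exists>n. (u, v) \<in> adj (open_edges E \<omega>) ^^ n) \<and> (u, v) \<in> V \<times> V" for \<omega>
      by (simp add: connection_def rtrancl_power)
    show ?thesis unfolding eq
      by (intro pred_intros_logic(3) pred_intros_countable(2) R) simp
  qed
  obtain a where "a \<in> S" using S by blast
  then have "same_cluster V E p S =
      {\<omega> \<in> space ?M. \<forall>x\<in>S. (a, x) \<in> connection V (open_edges E \<omega>)}"
    unfolding same_cluster_def clusters_def by (simp add: subset_component_iff)
  also have "\<dots> \<in> sets ?M"
    using C S by (intro predE pred_intros_finite) auto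
  finally show ?thesis .
qed

end

theory Submission
  imports Defs "HOL-Library.Sublist"
begin

text \<open>On a finite graph, explore the open cluster of \<open>a\<close> depth first, revealing one edge at a time, until
\<open>b\<close> or \<open>c\<close> is reached. Suppose \<open>b\<close> comes first. Write \<open>g\<close> for the conditional probability of \<open>abc\<close>
given what was revealed. Then \<open>P(abc, b first)\<close> is the expectation of \<open>g\<close> over the event that \<open>b\<close>
comes first, so by Cauchy-Schwarz its square is at most \<open>P(ab)\<close> times the expectation of \<open>g\<^sup>2\<close> over
that event. The factor \<open>g\<^sup>2\<close> is a probability for two copies \<open>X\<close>, \<open>Y\<close> of the unrevealed
edges, independent given the revealed part: \<open>c\<close> is joined to the explored cluster both in \<open>X\<close> and in
\<open>Y\<close>.

Because the search is depth first, an explored vertex off the stack has no unrevealed edge left. Hence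
\<open>c\<close> attaches to the stack, which is an open path from \<open>a\<close> to \<open>b\<close>, at a vertex \<open>v\<close> in \<open>X\<close> and at a
vertex \<open>w\<close> in \<open>Y\<close>. If \<open>v\<close> is not after \<open>w\<close>, cut the path at \<open>v\<close>: its first part with \<open>X\<close> joins \<open>a\<close>
to \<open>c\<close>, its second part with \<open>Y\<close> joins \<open>b\<close> to \<open>c\<close>. Otherwise the roles of \<open>X\<close> and \<open>Y\<close> are exchanged,
which costs a factor 2. The edges of the stack path were opened in the order in which they occur on it,
so cutting the path amounts to cutting the list of all open revealed edges at some moment.

The probability that such a cut exists is bounded by an inequality of van den Berg-Kesten type for
decision trees (\<open>decision_tree_vdBK\<close>): at the leaves of any decision tree, sharing the open revealed
edges between two copies, an initial segment for the first and the rest for the second, makes \<open>A\<close> and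
\<open>B\<close> happen with probability at most \<open>P(A) P(B)\<close>. Altogether
\<open>P(abc, b first)\<^sup>2 \<le> 2 P(ab) P(ac) P(bc)\<close>, and the same holds when \<open>c\<close> comes first. The first
inequality follows from \<open>(x + y)\<^sup>2 \<le> 2 x\<^sup>2 + 2 y\<^sup>2\<close>. For the second one the two cases are treated
together, with \<open>ab \<union> ac\<close> both as the event that the search succeeds and as the event \<open>A\<close>.

An infinite graph is exhausted by finite sets of edges; a connection uses finitely many edges, so all
probabilities involved are limits of those for the finite sets.\<close>

section \<open>Averages over finite configurations\<close>

text \<open>The expectation of \<open>f\<close> at the random set of open edges among \<open>U\<close>, for independent edges.\<close>

definition config_avg :: "('e \<Rightarrow> real) \<Rightarrow> 'e set \<Rightarrow> ('e set \<Rightarrow> real) \<Rightarrow> real" where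
  "config_avg p U f = (\<Sum>X\<in>Pow U. (\<Prod>e\<in>X. p e) * (\<Prod>e\<in>U - X. 1 - p e) * f X)"

lemma config_avg_split_edge:
  assumes "finite U" "e \<in> U"
  shows "config_avg p U f =
    p e * config_avg p (U - {e}) (\<lambda>X. f (insert e X)) + (1 - p e) * config_avg p (U - {e}) f"
proof -
  let ?W = "U - {e}"
  let ?w = "\<lambda>X. (\<Prod>e\<in>X. p e) * (\<Prod>e\<in>U - X. 1 - p e) * f X"
  have fin: "finite ?W" using assms by simp
  have nin: "e \<notin> ?W" by simp
  have U: "U = insert e ?W" using assms by auto
  have Pow: "Pow U = insert e ` Pow ?W \<union> Pow ?W"
    using Pow_insert[of e ?W] U by auto
  have "config_avg p U f = sum ?w (insert e ` Pow ?W) + sum ?w (Pow ?W)"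
    unfolding config_avg_def Pow using fin nin by (intro sum.union_disjoint) auto
  also have "sum ?w (insert e ` Pow ?W) = (\<Sum>X\<in>Pow ?W. ?w (insert e X))"
    by (subst sum.reindex) (auto simp: inj_on_def)
  also have "\<dots> = p e * config_avg p ?W (\<lambda>X. f (insert e X))"
    unfolding config_avg_def sum_distrib_left
  proof (rule sum.cong[OF refl])
    fix X assume X: "X \<in> Pow ?W"
    then have "finite X" "e \<notin> X" using fin by (auto intro: finite_subset)
    moreover have "U - insert e X = ?W - X" by auto
    ultimately show "?w (insert e X) =
        p e * ((\<Prod>e\<in>X. p e) * (\<Prod>e\<in>?W - X. 1 - p e) * f (insert e X))"
      by simp
  qed
  also have "sum ?w (Pow ?W) = (1 - p e) * config_avg p ?W f"
    unfolding config_avg_def sum_distrib_left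
  proof (rule sum.cong[OF refl])
    fix X assume X: "X \<in> Pow ?W"
    then have "U - X = insert e (?W - X)" "e \<notin> ?W - X" using U by auto
    then have "(\<Prod>e\<in>U - X. 1 - p e) = (1 - p e) * (\<Prod>e\<in>?W - X. 1 - p e)"
      using fin by simp
    then show "?w X = (1 - p e) * ((\<Prod>e\<in>X. p e) * (\<Prod>e\<in>?W - X. 1 - p e) * f X)"
      by simp
  qed
  finally show ?thesis .
qed

lemma config_avg_cmult: "config_avg p U (\<lambda>X. k * f X) = k * config_avg p U f"
  by (simp add: config_avg_def sum_distrib_left mult_ac)

lemma config_avg_add: "config_avg p U (\<lambda>X. f X + g X) = config_avg p U f + config_avg p U g"
  by (simp add: config_avg_def sum.distrib distrib_left)

lemma config_avg_const: "finite U \<Longrightarrow> config_avg p U (\<lambda>X. k) = k"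
proof (induction U rule: finite_induct)
  case (insert e U)
  then show ?case using config_avg_split_edge[of "insert e U" e p "\<lambda>X. k"]
    by (simp add: algebra_simps)
qed (simp add: config_avg_def)

text \<open>A product of expectations is an expectation over two independent copies.\<close>

lemma config_avg_mult:
  "config_avg p U f * config_avg p U g = config_avg p U (\<lambda>X. config_avg p U (\<lambda>Y. f X * g Y))"
proof -
  have "config_avg p U (\<lambda>X. config_avg p U (\<lambda>Y. f X * g Y)) =
      config_avg p U (\<lambda>X. config_avg p U g * f X)"
    by (simp add: config_avg_cmult mult_ac)
  then show ?thesis unfolding config_avg_cmult by (simp add: mult.commute)
qed

lemma config_avg_swap:
  "config_avg p U (\<lambda>X. config_avg p U (\<lambda>Y. f X Y)) = config_avg p U (\<lambda>Y. config_avg p U (\<lambda>X. f X Y))"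
  unfolding config_avg_def sum_distrib_left
  by (subst sum.swap) (simp add: mult_ac)

section \<open>Decision trees\<close>

text \<open>A tree prescribes which edge to reveal next, depending on the answers so far; \<open>Query e T1 T0\<close> continues
with \<open>T1\<close> if \<open>e\<close> is open and with \<open>T0\<close> if it is closed. A leaf is described by the list \<open>\<gamma>\<close> of
revealed open edges, in the order of their discovery, and by the set \<open>U\<close> of edges still unrevealed.\<close>

datatype 'e dtree = Stop | Query 'e "'e dtree" "'e dtree"

text \<open>The membership \<open>e \<in> U\<close> ensures that no edge is revealed twice along a branch.\<close>

fun all_leaves :: "('e list \<Rightarrow> 'e set \<Rightarrow> bool) \<Rightarrow> 'e dtree \<Rightarrow> 'e list \<Rightarrow> 'e set \<Rightarrow> bool" where
  "all_leaves P Stop \<gamma> U \<longleftrightarrow> P \<gamma> U"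
| "all_leaves P (Query e T1 T0) \<gamma> U \<longleftrightarrow>
    e \<in> U \<and> all_leaves P T1 (\<gamma> @ [e]) (U - {e}) \<and> all_leaves P T0 \<gamma> (U - {e})"

fun leaf_avg ::
    "('e \<Rightarrow> real) \<Rightarrow> ('e list \<Rightarrow> 'e set \<Rightarrow> real) \<Rightarrow> 'e dtree \<Rightarrow> 'e list \<Rightarrow> 'e set \<Rightarrow> real" where
  "leaf_avg p \<phi> Stop \<gamma> U = \<phi> \<gamma> U"
| "leaf_avg p \<phi> (Query e T1 T0) \<gamma> U =
    p e * leaf_avg p \<phi> T1 (\<gamma> @ [e]) (U - {e}) + (1 - p e) * leaf_avg p \<phi> T0 \<gamma> (U - {e})"

lemma all_leaves_mono:
  "all_leaves P T \<gamma> U \<Longrightarrow> (\<And>\<gamma> U. P \<gamma> U \<Longrightarrow> Q \<gamma> U) \<Longrightarrow> all_leaves Q T \<gamma> U"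
  by (induction T arbitrary: \<gamma> U) auto

lemma all_leaves_finite:
  "all_leaves P T \<gamma> U \<Longrightarrow> finite U \<Longrightarrow> all_leaves (\<lambda>\<gamma> U. P \<gamma> U \<and> finite U) T \<gamma> U"
  by (induction T arbitrary: \<gamma> U) auto

lemma leaf_avg_add:
  "leaf_avg p (\<lambda>\<gamma> U. \<phi> \<gamma> U + \<psi> \<gamma> U) T \<gamma> U = leaf_avg p \<phi> T \<gamma> U + leaf_avg p \<psi> T \<gamma> U"
  by (induction T arbitrary: \<gamma> U) (auto simp: algebra_simps)

lemma leaf_avg_cmult: "leaf_avg p (\<lambda>\<gamma> U. k * \<phi> \<gamma> U) T \<gamma> U = k * leaf_avg p \<phi> T \<gamma> U"
  by (induction T arbitrary: \<gamma> U) (auto simp: algebra_simps)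

text \<open>The tower property: revealing edges splits an expectation into conditional expectations at the leaves.\<close>

lemma config_avg_eq_leaf_avg:
  assumes "finite U" "all_leaves P T \<gamma> U"
  shows "config_avg p U (\<lambda>X. f (set \<gamma> \<union> X)) =
    leaf_avg p (\<lambda>\<gamma> U. config_avg p U (\<lambda>X. f (set \<gamma> \<union> X))) T \<gamma> U"
  using assms
proof (induction T arbitrary: \<gamma> U)
  case (Query e T1 T0)
  let ?W = "U - {e}"
  have "config_avg p ?W (\<lambda>X. f (set \<gamma> \<union> insert e X)) =
      leaf_avg p (\<lambda>\<gamma> U. config_avg p U (\<lambda>X. f (set \<gamma> \<union> X))) T1 (\<gamma> @ [e]) ?W"
    using Query.IH(1)[of ?W "\<gamma> @ [e]"] Query.prems by simp
  moreover have "config_avg p ?W (\<lambda>X. f (set \<gamma> \<union> X)) =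
      leaf_avg p (\<lambda>\<gamma> U. config_avg p U (\<lambda>X. f (set \<gamma> \<union> X))) T0 \<gamma> ?W"
    using Query.IH(2)[of ?W \<gamma>] Query.prems by simp
  ultimately show ?case
    using Query.prems config_avg_split_edge[of U e p "\<lambda>X. f (set \<gamma> \<union> X)"] by simp
qed simp

text \<open>The inductive step of Cauchy-Schwarz for trees: the bounds on the two subtrees combine at a query.\<close>

lemma convex_cauchy_schwarz:
  fixes x y :: real
  assumes "0 \<le> q" "q \<le> 1" "x\<^sup>2 \<le> a * b" "y\<^sup>2 \<le> c * d"
    and nonneg: "0 \<le> a" "0 \<le> b" "0 \<le> c" "0 \<le> d"
  shows "(q * x + (1 - q) * y)\<^sup>2 \<le> (q * a + (1 - q) * c) * (q * b + (1 - q) * d)"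
proof -
  have "(x * y)\<^sup>2 \<le> (a * b) * (c * d)"
    unfolding power_mult_distrib using assms by (intro mult_mono) auto
  also have "\<dots> = (a * d) * (b * c)" by (simp add: mult_ac)
  also have "\<dots> \<le> ((a * d + b * c) / 2)\<^sup>2"
    using sum_squares_bound[of "a*d" "b*c"]
    by (simp add: power2_eq_square field_simps)
  finally have "\<bar>x * y\<bar> \<le> \<bar>(a * d + b * c) / 2\<bar>" by (rule abs_le_square_iff[THEN iffD2])
  then have xy: "2 * (x * y) \<le> a * d + b * c" using nonneg by auto
  have "(q * x + (1 - q) * y)\<^sup>2 = q\<^sup>2 * x\<^sup>2 + (1 - q)\<^sup>2 * y\<^sup>2 + q * (1 - q) * (2 * (x * y))"
    by (simp add: power2_eq_square algebra_simps)
  also have "\<dots> \<le> q\<^sup>2 * (a * b) + (1 - q)\<^sup>2 * (c * d) + q * (1 - q) * (a * d + b * c)"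
    using assms xy by (intro add_mono mult_left_mono) auto
  also have "\<dots> = (q * a + (1 - q) * c) * (q * b + (1 - q) * d)"
    by (simp add: power2_eq_square algebra_simps)
  finally show ?thesis .
qed

text \<open>The open revealed edges are handed out to two copies of the unrevealed part, each edge to one copy only.
Handing out an initial segment, rather than an arbitrary subset, is what makes the induction over a
decision tree work.\<close>

definition splits ::
    "('e set \<Rightarrow> bool) \<Rightarrow> ('e set \<Rightarrow> bool) \<Rightarrow> 'e list \<Rightarrow> 'e set \<Rightarrow> 'e set \<Rightarrow> bool" where
  "splits A B \<gamma> X Y \<longleftrightarrow> (\<exists>\<gamma>1 \<gamma>2. \<gamma> = \<gamma>1 @ \<gamma>2 \<and> A (set \<gamma>1 \<union> X) \<and> B (set \<gamma>2 \<union> Y))"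

text \<open>When the last revealed edge is forgotten, it can be given back as an open edge to one of the two copies:
to the first if the cut comes after it, to the second otherwise.\<close>

lemma splits_snoc:
  assumes "splits A B (\<gamma> @ [e]) X Y"
  shows "splits A B \<gamma> (insert e X) Y \<or> splits A B \<gamma> X (insert e Y)"
proof -
  obtain \<gamma>1 \<gamma>2 where s: "\<gamma> @ [e] = \<gamma>1 @ \<gamma>2" "A (set \<gamma>1 \<union> X)" "B (set \<gamma>2 \<union> Y)"
    using assms by (auto simp: splits_def)
  show ?thesis
  proof (cases \<gamma>2 rule: rev_cases)
    case Nil
    then have "splits A B \<gamma> (insert e X) Y"
      using s unfolding splits_def by (intro exI[of _ \<gamma>] exI[of _ "[]"]) auto
    then show ?thesis ..
  next
    case (snoc \<gamma>2' e')
    then have "splits A B \<gamma> X (insert e Y)"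
      using s unfolding splits_def by (intro exI[of _ \<gamma>1] exI[of _ \<gamma>2']) auto
    then show ?thesis ..
  qed
qed

lemma splits_mono:
  assumes "mono A" "mono B" "splits A B \<gamma> X Y" "X \<subseteq> X'" "Y \<subseteq> Y'"
  shows "splits A B \<gamma> X' Y'"
proof -
  obtain \<gamma>1 \<gamma>2 where s: "\<gamma> = \<gamma>1 @ \<gamma>2" "A (set \<gamma>1 \<union> X)" "B (set \<gamma>2 \<union> Y)"
    using assms by (auto simp: splits_def)
  have "A (set \<gamma>1 \<union> X')" using monoD[OF assms(1), of "set \<gamma>1 \<union> X" "set \<gamma>1 \<union> X'"] s assms by auto
  moreover have "B (set \<gamma>2 \<union> Y')"
    using monoD[OF assms(2), of "set \<gamma>2 \<union> Y" "set \<gamma>2 \<union> Y'"] s assms by auto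
  ultimately show ?thesis using s by (auto simp: splits_def)
qed

locale edge_probabilities =
  fixes p :: "'e \<Rightarrow> real"
  assumes p_nonneg: "0 \<le> p e" and p_le_1: "p e \<le> 1"
begin

lemma config_avg_mono:
  assumes "\<And>X. X \<subseteq> U \<Longrightarrow> f X \<le> g X"
  shows "config_avg p U f \<le> config_avg p U g"
  unfolding config_avg_def
  by (intro sum_mono mult_left_mono assms mult_nonneg_nonneg prod_nonneg)
     (auto simp: p_nonneg p_le_1)

lemma config_avg_nonneg:
  assumes "\<And>X. X \<subseteq> U \<Longrightarrow> 0 \<le> f X"
  shows "0 \<le> config_avg p U f"
  using config_avg_mono[of U "\<lambda>_. 0" f] assms by (simp add: config_avg_def)

lemma leaf_avg_mono:
  assumes "all_leaves (\<lambda>\<gamma> U. \<phi> \<gamma> U \<le> \<psi> \<gamma> U) T \<gamma> U"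
  shows "leaf_avg p \<phi> T \<gamma> U \<le> leaf_avg p \<psi> T \<gamma> U"
  using assms
  by (induction T arbitrary: \<gamma> U) (auto intro!: add_mono mult_left_mono simp: p_nonneg p_le_1)

lemma leaf_avg_nonneg:
  assumes "\<And>\<gamma> U. 0 \<le> \<phi> \<gamma> U"
  shows "0 \<le> leaf_avg p \<phi> T \<gamma> U"
  using assms by (induction T arbitrary: \<gamma> U) (auto simp: p_nonneg p_le_1)

lemma leaf_avg_cauchy_schwarz:
  "(leaf_avg p (\<lambda>\<gamma> U. \<phi> \<gamma> U * \<psi> \<gamma> U) T \<gamma> U)\<^sup>2 \<le>
    leaf_avg p (\<lambda>\<gamma> U. (\<phi> \<gamma> U)\<^sup>2) T \<gamma> U * leaf_avg p (\<lambda>\<gamma> U. (\<psi> \<gamma> U)\<^sup>2) T \<gamma> U"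
proof (induction T arbitrary: \<gamma> U)
  case (Query e T1 T0)
  show ?case
    unfolding leaf_avg.simps
    by (rule convex_cauchy_schwarz[OF p_nonneg p_le_1 Query.IH]) (rule leaf_avg_nonneg, simp)+
qed (simp add: power_mult_distrib)

text \<open>Revealing an edge \<open>e\<close> does not increase the probability that a good cut exists. Before \<open>e\<close> is revealed,
the two copies have independent states of \<open>e\<close>; afterwards a common state is revealed, and an open \<open>e\<close>
goes to only one of them. Let \<open>r\<close> denote the indicator before the query with indices for the states of
\<open>e\<close> in the two copies, and \<open>s\<close> the indicator after \<open>e\<close> was revealed as open. By \<open>splits_snoc\<close> the
indicator \<open>s\<close> forces \<open>r10\<close> or \<open>r01\<close>, and monotonicity gives \<open>r00 \<le> r10, r01 \<le> r11\<close>. Hence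
\<open>s + r00 \<le> r10 + r01\<close> and \<open>s \<le> r11\<close>, which is enough for every value of \<open>p e\<close>. At the root the list is
empty and the probability is \<open>P(A) P(B)\<close>.\<close>

theorem decision_tree_vdBK:
  assumes mono: "mono A" "mono B" and "finite U" "all_leaves P T \<gamma> U"
  shows "leaf_avg p (\<lambda>\<gamma> U. config_avg p U (\<lambda>X. config_avg p U (\<lambda>Y. of_bool (splits A B \<gamma> X Y)))) T \<gamma> U
    \<le> config_avg p U (\<lambda>X. config_avg p U (\<lambda>Y. of_bool (splits A B \<gamma> X Y)))"
  using assms(3,4)
proof (induction T arbitrary: \<gamma> U)
  case (Query e T1 T0)
  let ?W = "U - {e}"
  let ?q = "1 - p e"
  let ?r = "\<lambda>X Y. of_bool (splits A B \<gamma> X Y) :: real"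
  let ?s = "\<lambda>X Y. of_bool (splits A B (\<gamma> @ [e]) X Y) :: real"
  let ?E = "\<lambda>f. config_avg p ?W (\<lambda>X. config_avg p ?W (\<lambda>Y. f X Y))"
  note U = Query.prems(1) Query.prems(2)[simplified, THEN conjunct1]
  have pq: "0 \<le> p e" "0 \<le> ?q" by (simp_all add: p_nonneg p_le_1)
  have "p e * ?s X Y + ?q * ?r X Y \<le>
      p e * (p e * ?r (insert e X) (insert e Y) + ?q * ?r (insert e X) Y)
      + ?q * (p e * ?r X (insert e Y) + ?q * ?r X Y)" for X Y
  proof -
    let ?r11 = "?r (insert e X) (insert e Y)"
    let ?r10 = "?r (insert e X) Y"
    let ?r01 = "?r X (insert e Y)"
    have le: "?r X Y \<le> ?r10" "?r X Y \<le> ?r01" "?r10 \<le> ?r11" "?r01 \<le> ?r11"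
      by (auto intro: splits_mono[OF mono] simp: subset_insertI)
    have "?s X Y + ?r X Y \<le> ?r10 + ?r01" "?s X Y \<le> ?r11"
      using splits_snoc[of A B \<gamma> e X Y] le by (auto split: if_splits simp: of_bool_def)
    note sum_le = mult_left_mono[OF this(1), of "p e * ?q"] mult_left_mono[OF this(2), of "p e * p e"]
    have eq: "p e * ?s X Y + ?q * ?r X Y =
        p e * ?q * (?s X Y + ?r X Y) + p e * p e * ?s X Y + ?q * ?q * ?r X Y"
      by (simp add: algebra_simps)
    have "p e * ?s X Y + ?q * ?r X Y \<le>
        p e * ?q * (?r10 + ?r01) + p e * p e * ?r11 + ?q * ?q * ?r X Y"
      unfolding eq using sum_le pq by (intro add_mono) auto
    then show ?thesis by (simp add: algebra_simps)
  qed
  then have "?E (\<lambda>X Y. p e * ?s X Y + ?q * ?r X Y) \<le>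
      ?E (\<lambda>X Y. p e * (p e * ?r (insert e X) (insert e Y) + ?q * ?r (insert e X) Y)
        + ?q * (p e * ?r X (insert e Y) + ?q * ?r X Y))"
    by (intro config_avg_mono)
  also have "\<dots> = config_avg p U (\<lambda>X. config_avg p U (\<lambda>Y. ?r X Y))"
    using U by (simp add: config_avg_split_edge[of U e] config_avg_add config_avg_cmult)
      (simp add: algebra_simps)
  finally have root: "p e * ?E ?s + ?q * ?E ?r \<le> config_avg p U (\<lambda>X. config_avg p U (\<lambda>Y. ?r X Y))"
    by (simp add: config_avg_add config_avg_cmult)
  have "leaf_avg p (\<lambda>\<gamma> U. config_avg p U (\<lambda>X. config_avg p U (\<lambda>Y. of_bool (splits A B \<gamma> X Y))))
      (Query e T1 T0) \<gamma> U \<le> p e * ?E ?s + ?q * ?E ?r"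
    unfolding leaf_avg.simps using Query.prems pq
    by (intro add_mono mult_left_mono Query.IH) auto
  then show ?case using root by linarith
qed simp

text \<open>Cauchy-Schwarz over the leaves in \<open>H\<close>, with the squared conditional probability of \<open>D\<close> read as a
probability for two copies. The hypothesis on the leaves says that two copies that both satisfy \<open>D\<close>
admit a cut for \<open>A\<close> and \<open>B\<close> in one of the two orders; the factor 2 counts these orders.\<close>

theorem decision_tree_square:
  assumes mono: "mono A" "mono B" "mono Q" and "finite U"
    and leaves: "all_leaves (\<lambda>\<gamma> U. H \<gamma> U \<longrightarrow> Q (set \<gamma>) \<and>
      (\<forall>X\<subseteq>U. \<forall>Y\<subseteq>U. D (set \<gamma> \<union> X) \<longrightarrow> D (set \<gamma> \<union> Y) \<longrightarrow>
        splits A B \<gamma> X Y \<or> splits A B \<gamma> Y X)) T [] U"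
  shows "(leaf_avg p (\<lambda>\<gamma> U. of_bool (H \<gamma> U) * config_avg p U (\<lambda>X. of_bool (D (set \<gamma> \<union> X)))) T [] U)\<^sup>2
    \<le> 2 * config_avg p U (\<lambda>X. of_bool (Q X)) *
      (config_avg p U (\<lambda>X. of_bool (A X)) * config_avg p U (\<lambda>X. of_bool (B X)))"
proof -
  let ?d = "\<lambda>\<gamma> U. config_avg p U (\<lambda>X. of_bool (D (set \<gamma> \<union> X))) :: real"
  let ?h = "\<lambda>\<gamma> U. of_bool (H \<gamma> U) :: real"
  let ?s = "\<lambda>\<gamma> U. config_avg p U (\<lambda>X. config_avg p U (\<lambda>Y. of_bool (splits A B \<gamma> X Y)))"
  note leaves' = all_leaves_finite[OF leaves assms(4)]
  have "leaf_avg p (\<lambda>\<gamma> U. (?h \<gamma> U)\<^sup>2) T [] U \<le>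
      leaf_avg p (\<lambda>\<gamma> U. config_avg p U (\<lambda>X. of_bool (Q (set \<gamma> \<union> X)))) T [] U"
  proof (rule leaf_avg_mono, rule all_leaves_mono[OF leaves'], goal_cases)
    case (1 \<gamma> U)
    show ?case
    proof (cases "H \<gamma> U")
      case True
      then have "Q (set \<gamma> \<union> X)" for X
        using 1 monoD[OF mono(3), of "set \<gamma>" "set \<gamma> \<union> X"] by auto
      then show ?thesis using 1 by (simp add: config_avg_const)
    qed (auto intro: config_avg_nonneg)
  qed
  also have "\<dots> = config_avg p U (\<lambda>X. of_bool (Q X))"
    using config_avg_eq_leaf_avg[OF assms(4) leaves, of p "\<lambda>X. of_bool (Q X)"] by simp
  finally have hit: "leaf_avg p (\<lambda>\<gamma> U. (?h \<gamma> U)\<^sup>2) T [] U \<le> config_avg p U (\<lambda>X. of_bool (Q X))" .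
  have "leaf_avg p (\<lambda>\<gamma> U. (?h \<gamma> U * ?d \<gamma> U)\<^sup>2) T [] U \<le> leaf_avg p (\<lambda>\<gamma> U. 2 * ?s \<gamma> U) T [] U"
  proof (rule leaf_avg_mono, rule all_leaves_mono[OF leaves'], goal_cases)
    case (1 \<gamma> U)
    show ?case
    proof (cases "H \<gamma> U")
      case True
      have "(?d \<gamma> U)\<^sup>2 = config_avg p U (\<lambda>X. config_avg p U (\<lambda>Y.
          of_bool (D (set \<gamma> \<union> X)) * of_bool (D (set \<gamma> \<union> Y))))"
        by (simp add: power2_eq_square config_avg_mult)
      also have "\<dots> \<le> config_avg p U (\<lambda>X. config_avg p U (\<lambda>Y.
          of_bool (splits A B \<gamma> X Y) + of_bool (splits A B \<gamma> Y X)))"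
        using 1 True by (intro config_avg_mono) (auto simp: of_bool_def)
      also have "\<dots> = ?s \<gamma> U + config_avg p U (\<lambda>X. config_avg p U (\<lambda>Y. of_bool (splits A B \<gamma> Y X)))"
        by (simp add: config_avg_add)
      also have "\<dots> = 2 * ?s \<gamma> U"
        by (subst (2) config_avg_swap) simp
      finally show ?thesis using True by simp
    qed (auto intro!: config_avg_nonneg)
  qed
  also have "\<dots> = 2 * leaf_avg p ?s T [] U" by (rule leaf_avg_cmult)
  also have "\<dots> \<le> 2 * ?s [] U"
    using decision_tree_vdBK[OF mono(1,2) assms(4) leaves] by simp
  also have "?s [] U = config_avg p U (\<lambda>X. of_bool (A X)) * config_avg p U (\<lambda>X. of_bool (B X))"
    unfolding config_avg_mult by (simp add: splits_def of_bool_conj)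
  finally have pairs: "leaf_avg p (\<lambda>\<gamma> U. (?h \<gamma> U * ?d \<gamma> U)\<^sup>2) T [] U \<le>
      2 * (config_avg p U (\<lambda>X. of_bool (A X)) * config_avg p U (\<lambda>X. of_bool (B X)))" .
  \<comment> \<open>The indicator is duplicated, so that both factors of Cauchy-Schwarz see only the leaves in \<open>H\<close>.\<close>
  have "(leaf_avg p (\<lambda>\<gamma> U. ?h \<gamma> U * ?d \<gamma> U) T [] U)\<^sup>2 =
      (leaf_avg p (\<lambda>\<gamma> U. ?h \<gamma> U * (?h \<gamma> U * ?d \<gamma> U)) T [] U)\<^sup>2"
    by (rule arg_cong[where f = "\<lambda>\<phi>. (leaf_avg p \<phi> T [] U)\<^sup>2"]) (simp add: fun_eq_iff of_bool_def)
  also have "\<dots> \<le> leaf_avg p (\<lambda>\<gamma> U. (?h \<gamma> U)\<^sup>2) T [] U * leaf_avg p (\<lambda>\<gamma> U. (?h \<gamma> U * ?d \<gamma> U)\<^sup>2) T [] U"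
    by (rule leaf_avg_cauchy_schwarz)
  also have "\<dots> \<le> config_avg p U (\<lambda>X. of_bool (Q X)) *
      (2 * (config_avg p U (\<lambda>X. of_bool (A X)) * config_avg p U (\<lambda>X. of_bool (B X))))"
    by (intro mult_mono hit pairs leaf_avg_nonneg config_avg_nonneg) auto
  finally show ?thesis by (simp add: mult_ac)
qed

end

section \<open>Depth-first exploration of a cluster\<close>

abbreviation linked :: "'v set set \<Rightarrow> 'v \<Rightarrow> 'v \<Rightarrow> bool" where
  "linked X u v \<equiv> (u, v) \<in> (adj X)\<^sup>*"

lemma linked_sym: "linked X u v \<Longrightarrow> linked X v u"
  using sym_rtrancl[OF sym_adj[of X]] by (auto simp: sym_def)

lemma linked_trans: "linked X u v \<Longrightarrow> linked X v w \<Longrightarrow> linked X u w"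
  by (rule rtrancl_trans)

lemma linked_mono: "linked X u v \<Longrightarrow> X \<subseteq> Y \<Longrightarrow> linked Y u v"
  using rtrancl_mono[of "adj X" "adj Y"] by (auto simp: adj_def)

lemma mono_linked: "mono (\<lambda>X. linked X u v)"
  by (intro monoI le_boolI) (rule linked_mono)

fun path_edges :: "'v list \<Rightarrow> 'v set list" where
  "path_edges (u # v # vs) = {u, v} # path_edges (v # vs)"
| "path_edges _ = []"

lemma path_edges_append: "path_edges (us @ v # vs) = path_edges (us @ [v]) @ path_edges (v # vs)"
proof (induction us)
  case (Cons u us)
  then show ?case by (cases us) auto
qed simp

lemma linked_path_last:
  assumes "v \<in> set vs"
  shows "linked (set (path_edges vs)) v (last vs)"
  using assms
proof (induction vs arbitrary: v rule: path_edges.induct)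
  case (1 u w vs)
  let ?X = "set (path_edges (u # w # vs))"
  have uw: "linked ?X u w"
    by (rule r_into_rtrancl) (simp add: adj_def)
  have IH: "linked ?X x (last (w # vs))" if "x \<in> set (w # vs)" for x
    using 1(1)[OF that] by (rule linked_mono) auto
  show ?case
  proof (cases "v = u")
    case True
    then show ?thesis using linked_trans[OF uw IH[of w]] by simp
  next
    case False
    then show ?thesis using 1(2) IH[of v] by simp
  qed
qed auto

lemma linked_path_ends:
  assumes "vs \<noteq> []"
  shows "linked (set (path_edges vs)) (hd vs) (last vs)"
  using assms by (intro linked_path_last) simp

text \<open>Of two vertices on a path, one comes no later than the other. This decides which copy takes the first
part of the path.\<close>

lemma split_list_either_order:
  assumes "v \<in> set vs" "w \<in> set vs"
  shows "(\<exists>us us'. vs = us @ v # us' \<and> w \<in> set (v # us')) \<or>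
    (\<exists>us us'. vs = us @ w # us' \<and> v \<in> set (w # us'))"
proof -
  obtain us us' where vs: "vs = us @ v # us'" using assms(1) by (auto dest: split_list)
  show ?thesis
  proof (cases "w \<in> set (v # us')")
    case True
    then show ?thesis using vs by blast
  next
    case False
    then have "w \<in> set us" using assms(2) vs by auto
    then obtain ts ts' where "us = ts @ w # ts'" by (auto dest: split_list)
    then have "vs = ts @ w # (ts' @ v # us')" "v \<in> set (w # ts' @ v # us')" using vs by auto
    then show ?thesis by blast
  qed
qed

lemma subseq_set: "subseq xs ys \<Longrightarrow> set xs \<subseteq> set ys"
  by (induction rule: list_emb.induct) auto

text \<open>The invariant of the depth-first search from \<open>a\<close>: \<open>W\<close> is the set of vertices reached so far and \<open>vs\<close> the
stack, a path from \<open>a\<close> to the vertex whose edges are currently examined; an empty stack means that the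
search is exhausted. The last condition expresses that the edges at a vertex that was popped have all
been revealed. The subsequence condition records that the path was opened from \<open>a\<close> onwards, so that a
cut of the path is induced by a cut of \<open>\<gamma>\<close>.\<close>

definition dfs_state :: "'v \<Rightarrow> 'v set list \<Rightarrow> 'v set set \<Rightarrow> 'v set \<Rightarrow> 'v list \<Rightarrow> bool" where
  "dfs_state a \<gamma> U W vs \<longleftrightarrow>
    a \<in> W \<and> (vs \<noteq> [] \<longrightarrow> hd vs = a) \<and> set vs \<subseteq> W \<and> subseq (path_edges vs) \<gamma> \<and>
    (\<forall>e\<in>set \<gamma>. e \<subseteq> W) \<and> (\<forall>e\<in>U. e \<inter> W \<subseteq> set vs)"

text \<open>Follow the connection from \<open>c\<close> to \<open>a\<close> up to its first vertex in \<open>W\<close>. All earlier vertices lie outside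
\<open>W\<close>, so none of the edges used is in \<open>\<gamma>\<close>; the last of them is unrevealed and touches \<open>W\<close>, hence it
touches \<open>W\<close> on the stack. In particular, \<open>c\<close> cannot be reached any more once the stack is empty.\<close>

lemma dfs_state_attach:
  assumes st: "dfs_state a \<gamma> U W vs" and "c \<notin> W" "X \<subseteq> U"
    and link: "linked (set \<gamma> \<union> X) a c"
  obtains v where "v \<in> set vs" "linked X c v"
proof -
  have "(\<exists>v\<in>set vs. linked X c v) \<or> (linked X c z \<and> z \<notin> W)" if "linked (set \<gamma> \<union> X) c z" for z
    using that
  proof (induction rule: rtrancl_induct)
    case base
    then show ?case using \<open>c \<notin> W\<close> by simp
  next
    case (step y z)
    show ?case
    proof (cases "\<exists>v\<in>set vs. linked X c v")
      case False
      then have y: "linked X c y" "y \<notin> W" using step.IH by auto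
      have "{y, z} \<notin> set \<gamma>" using y st by (auto simp: dfs_state_def)
      then have yz: "{y, z} \<in> X" using step.hyps by (auto simp: adj_def)
      then have cz: "linked X c z" by (intro rtrancl_into_rtrancl[OF y(1)]) (simp add: adj_def)
      have "z \<in> set vs" if "z \<in> W"
      proof -
        have "{y, z} \<in> U" using yz \<open>X \<subseteq> U\<close> by blast
        then have "{y, z} \<inter> W \<subseteq> set vs" using st by (simp only: dfs_state_def)
        then show ?thesis using that by blast
      qed
      then show ?thesis using cz by blast
    qed simp
  qed
  from this[OF linked_sym[OF link]] have "\<exists>v\<in>set vs. linked X c v"
    using st unfolding dfs_state_def by simp
  then show thesis using that by blast
qed

text \<open>The search has just put \<open>b\<close> on top of the stack, and \<open>c\<close> has not been reached.\<close>

definition first_reach :: "'v \<Rightarrow> 'v \<Rightarrow> 'v \<Rightarrow> 'v set list \<Rightarrow> 'v set set \<Rightarrow> bool" where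
  "first_reach a b c \<gamma> U \<longleftrightarrow> (\<exists>W vs. dfs_state a \<gamma> U W vs \<and> vs \<noteq> [] \<and> last vs = b \<and> c \<notin> W)"

lemma first_reach_linked:
  assumes "first_reach a b c \<gamma> U"
  shows "linked (set \<gamma>) a b"
proof -
  obtain W vs where st: "dfs_state a \<gamma> U W vs" "vs \<noteq> []" "last vs = b"
    using assms unfolding first_reach_def by blast
  then have a: "hd vs = a" and sub: "subseq (path_edges vs) \<gamma>" by (auto simp: dfs_state_def)
  show ?thesis
    using linked_mono[OF linked_path_ends[OF st(2)] subseq_set[OF sub]] a st(3) by simp
qed

text \<open>Cut the stack path at the attachment vertex of \<open>c\<close> that is closer to \<open>a\<close>. The copy in which \<open>c\<close> attaches
there gets the part from \<open>a\<close>, the other copy gets the part to \<open>b\<close>, which contains its own attachment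
vertex.\<close>

lemma first_reach_splits:
  assumes "first_reach a b c \<gamma> U" "X \<subseteq> U" "Y \<subseteq> U"
    and "linked (set \<gamma> \<union> X) a c" "linked (set \<gamma> \<union> Y) a c"
  shows "splits (\<lambda>X. linked X a c) (\<lambda>X. linked X b c) \<gamma> X Y \<or>
    splits (\<lambda>X. linked X a c) (\<lambda>X. linked X b c) \<gamma> Y X"
proof -
  obtain W vs where st: "dfs_state a \<gamma> U W vs" and vs: "vs \<noteq> []" "last vs = b" "c \<notin> W"
    using assms(1) unfolding first_reach_def by blast
  then have a: "hd vs = a" and sub: "subseq (path_edges vs) \<gamma>" by (auto simp: dfs_state_def)
  have splits: "splits (\<lambda>X. linked X a c) (\<lambda>X. linked X b c) \<gamma> X Y"
    if vs': "vs = us @ v # us'" and w: "w \<in> set (v # us')" and X: "linked X c v" and Y: "linked Y c w"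
    for us us' v w X Y
  proof -
    obtain \<gamma>1 \<gamma>2 where \<gamma>: "\<gamma> = \<gamma>1 @ \<gamma>2"
      and sub1: "subseq (path_edges (us @ [v])) \<gamma>1" and sub2: "subseq (path_edges (v # us')) \<gamma>2"
      using list_emb_appendD[OF sub[unfolded vs' path_edges_append[of us v us']]] by blast
    have "hd (us @ [v]) = a" using a vs' by (cases us) auto
    then have "linked (set (path_edges (us @ [v]))) a v"
      using linked_path_ends[of "us @ [v]"] by simp
    then have "linked (set \<gamma>1 \<union> X) a v" by (rule linked_mono) (use subseq_set[OF sub1] in auto)
    moreover have "linked (set \<gamma>1 \<union> X) v c" by (rule linked_mono[OF linked_sym[OF X]]) simp
    ultimately have 1: "linked (set \<gamma>1 \<union> X) a c" by (rule linked_trans)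
    have "linked (set (path_edges (v # us'))) w b"
      using linked_path_last[OF w] vs vs' by simp
    then have "linked (set \<gamma>2 \<union> Y) w b" by (rule linked_mono) (use subseq_set[OF sub2] in auto)
    then have "linked (set \<gamma>2 \<union> Y) b w" by (rule linked_sym)
    moreover have "linked (set \<gamma>2 \<union> Y) w c" by (rule linked_mono[OF linked_sym[OF Y]]) simp
    ultimately have 2: "linked (set \<gamma>2 \<union> Y) b c" by (rule linked_trans)
    show ?thesis unfolding splits_def using 1 2 \<gamma> by blast
  qed
  obtain v where v: "v \<in> set vs" "linked X c v"
    using dfs_state_attach[OF st vs(3) assms(2,4)] .
  obtain w where w: "w \<in> set vs" "linked Y c w"
    using dfs_state_attach[OF st vs(3) assms(3,5)] .
  from split_list_either_order[OF v(1) w(1)] show ?thesis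
  proof (elim disjE exE conjE)
    fix us us' assume "vs = us @ v # us'" "w \<in> set (v # us')"
    then show ?thesis using splits[OF _ _ v(2) w(2)] by simp
  next
    fix us us' assume "vs = us @ w # us'" "v \<in> set (w # us')"
    then show ?thesis using splits[OF _ _ w(2) v(2)] by simp
  qed
qed

text \<open>Depth-first search as a decision tree. If the top of the stack has an unrevealed edge, reveal it; if the
edge is open and leads to a new vertex, push this vertex, or stop if it is \<open>b\<close> or \<open>c\<close>. If there is no
such edge, pop the stack. A push uses up an edge and lengthens the stack by one, a pop only shortens it;
hence the weight 2 for edges in the termination measure.\<close>

lemma dfs_tree_exists:
  assumes "dfs_state a \<gamma> U W vs" "finite U" "\<forall>e\<in>U. card e = 2" "b \<notin> W" "c \<notin> W" "b \<noteq> c"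
  shows "\<exists>T. all_leaves (\<lambda>\<gamma> U. first_reach a b c \<gamma> U \<or> first_reach a c b \<gamma> U \<or>
    (\<exists>W. dfs_state a \<gamma> U W [] \<and> b \<notin> W \<and> c \<notin> W)) T \<gamma> U"
    (is "\<exists>T. all_leaves ?P T \<gamma> U")
  using assms
proof (induction "2 * card U + length vs" arbitrary: \<gamma> U W vs rule: less_induct)
  case less
  note st = less.prems(1)
  have IH: "\<exists>T. all_leaves ?P T \<gamma>' U'"
    if "dfs_state a \<gamma>' U' W' vs'" "2 * card U' + length vs' < 2 * card U + length vs"
      "U' \<subseteq> U" "b \<notin> W'" "c \<notin> W'" for \<gamma>' U' W' vs'
    by (rule less.hyps[OF that(2,1)]) (use that less.prems in \<open>auto intro: finite_subset\<close>)
  show ?case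
  proof (cases vs rule: rev_cases)
    case Nil
    then have "all_leaves ?P Stop \<gamma> U" using less.prems by auto
    then show ?thesis ..
  next
    case (snoc us v)
    then have "vs \<noteq> []" and vs_set: "set vs = insert v (set us)" by auto
    show ?thesis
    proof (cases "\<exists>e\<in>U. v \<in> e")
      case True
      then obtain e where e: "e \<in> U" "v \<in> e" by blast
      obtain x y where "e = {x, y}"
        using e less.prems(3) by (metis card_2_iff)
      then obtain w where w: "e = {v, w}"
        using e(2) that[of x] that[of y] by (auto simp: insert_commute)
      let ?U = "U - {e}"
      have U: "card ?U < card U"
        by (rule card_Diff1_less[OF less.prems(2) e(1)])
      have "v \<in> W" using st snoc unfolding dfs_state_def by auto
      have "dfs_state a \<gamma> ?U W vs" using st by (auto simp: dfs_state_def)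
      then obtain T0 where T0: "all_leaves ?P T0 \<gamma> ?U"
        using IH[of \<gamma> ?U W vs] U less.prems(4,5) by auto
      have "\<exists>T1. all_leaves ?P T1 (\<gamma> @ [e]) ?U"
      proof (cases "w \<in> W")
        case True
        have "dfs_state a (\<gamma> @ [e]) ?U W vs"
          using st \<open>v \<in> W\<close> True w unfolding dfs_state_def
          by (auto intro: subseq_rev_drop_many)
        then show ?thesis using IH[of "\<gamma> @ [e]" ?U W vs] U less.prems(4,5) by auto
      next
        case new: False
        let ?vs = "vs @ [w]"
        have pe: "path_edges ?vs = path_edges vs @ [e]"
          using w snoc path_edges_append[of us v "[w]"] by simp
        have st': "dfs_state a (\<gamma> @ [e]) ?U (insert w W) ?vs"
          unfolding dfs_state_def pe
        proof (intro conjI ballI impI)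
          show "f \<subseteq> insert w W" if "f \<in> set (\<gamma> @ [e])" for f
            using that st w \<open>v \<in> W\<close> unfolding dfs_state_def by auto
          show "f \<inter> insert w W \<subseteq> set ?vs" if "f \<in> ?U" for f
          proof -
            have "f \<inter> W \<subseteq> set vs" using that st unfolding dfs_state_def by blast
            then show ?thesis by auto
          qed
        qed (use st \<open>vs \<noteq> []\<close> in \<open>auto simp: dfs_state_def\<close>)
        show ?thesis
        proof (cases "w = b \<or> w = c")
          case True
          have "first_reach a b c (\<gamma> @ [e]) ?U" if "w = b"
            unfolding first_reach_def using st' less.prems(4-6) that
            by (intro exI[of _ "insert w W"] exI[of _ ?vs]) auto
          moreover have "first_reach a c b (\<gamma> @ [e]) ?U" if "w = c"
            unfolding first_reach_def using st' less.prems(4-6) that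
            by (intro exI[of _ "insert w W"] exI[of _ ?vs]) auto
          ultimately have "all_leaves ?P Stop (\<gamma> @ [e]) ?U" using True by auto
          then show ?thesis ..
        next
          case False
          then show ?thesis
            using IH[of "\<gamma> @ [e]" ?U "insert w W" ?vs] st' U less.prems(4,5) by auto
        qed
      qed
      then obtain T1 where "all_leaves ?P T1 (\<gamma> @ [e]) ?U" ..
      then have "all_leaves ?P (Query e T1 T0) \<gamma> U" using T0 e by simp
      then show ?thesis ..
    next
      case dead: False
      have "subseq (path_edges us) (path_edges vs)"
      proof (cases us rule: rev_cases)
        case (snoc ts t)
        then have "path_edges vs = path_edges us @ [{t, v}]"
          using \<open>vs = us @ [v]\<close> path_edges_append[of ts t "[v]"] by simp
        then show ?thesis by (simp add: subseq_rev_drop_many)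
      qed simp
      then have sub: "subseq (path_edges us) \<gamma>"
        using st unfolding dfs_state_def by (blast intro: subseq_order.trans)
      have "dfs_state a \<gamma> U W us"
        unfolding dfs_state_def
      proof (intro conjI ballI impI)
        show "hd us = a" if "us \<noteq> []"
          using st that snoc unfolding dfs_state_def by simp
        show "e \<inter> W \<subseteq> set us" if "e \<in> U" for e
        proof -
          have "e \<inter> W \<subseteq> insert v (set us)"
            using st that vs_set unfolding dfs_state_def by blast
          then show ?thesis using dead that by blast
        qed
        show "e \<subseteq> W" if "e \<in> set \<gamma>" for e
          using st that unfolding dfs_state_def by blast
      qed (use st sub vs_set in \<open>auto simp: dfs_state_def\<close>)
      moreover have "length us < length vs" using snoc by simp
      ultimately show ?thesis using IH[of \<gamma> U W us] less.prems(4,5) by auto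
    qed
  qed
qed

section \<open>The inequalities on a finite graph\<close>

lemma splits_weaken:
  assumes "splits A B \<gamma> X Y" "\<And>X. A X \<Longrightarrow> A' X"
  shows "splits A' B \<gamma> X Y"
  using assms unfolding splits_def by blast

text \<open>Leaves of the search at which neither \<open>b\<close> nor \<open>c\<close> was reached contribute nothing to \<open>P(abc)\<close>. The three
applications of \<open>decision_tree_square\<close> concern the leaves where \<open>b\<close> was reached first, those where \<open>c\<close>
was, and both kinds together.\<close>

theorem finite_connection_inequalities:
  fixes p :: "'v set \<Rightarrow> real"
  assumes "edge_probabilities p" "finite F" "\<forall>e\<in>F. card e = 2"
    and distinct: "a \<noteq> b" "a \<noteq> c" "b \<noteq> c"
  defines "Pr \<equiv> \<lambda>Q. config_avg p F (\<lambda>X. of_bool (Q X))"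
  shows "(Pr (\<lambda>X. linked X a b \<and> linked X a c))\<^sup>2 \<le>
      8 * Pr (\<lambda>X. linked X a b) * Pr (\<lambda>X. linked X a c) * Pr (\<lambda>X. linked X b c)" (is ?thesis1)
    and "(Pr (\<lambda>X. linked X a b \<and> linked X a c))\<^sup>2 \<le>
      2 * (Pr (\<lambda>X. linked X a b \<or> linked X a c))\<^sup>2 * Pr (\<lambda>X. linked X b c)" (is ?thesis2)
proof -
  interpret edge_probabilities p by fact
  let ?D = "\<lambda>X. linked X a b \<and> linked X a c"
  let ?or = "\<lambda>X. linked X a b \<or> linked X a c"
  let ?d = "\<lambda>\<gamma> U. config_avg p U (\<lambda>X. of_bool (?D (set \<gamma> \<union> X))) :: real"
  let ?hb = "first_reach a b c" and ?hc = "first_reach a c b"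
  have "dfs_state a [] F {a} [a]" by (auto simp: dfs_state_def)
  then obtain T where leaves: "all_leaves (\<lambda>\<gamma> U. ?hb \<gamma> U \<or> ?hc \<gamma> U \<or>
      (\<exists>W. dfs_state a \<gamma> U W [] \<and> b \<notin> W \<and> c \<notin> W)) T [] F"
    using dfs_tree_exists[of a "[]" F "{a}" "[a]" b c] assms(2,3) distinct by auto
  define avg where "avg H = leaf_avg p (\<lambda>\<gamma> U. of_bool (H \<gamma> U) * ?d \<gamma> U) T [] F" for H
  have root: "Pr ?D = leaf_avg p ?d T [] F"
    using config_avg_eq_leaf_avg[OF assms(2) leaves, of p "\<lambda>X. of_bool (?D X)"] by (simp add: Pr_def)
  have nonneg: "0 \<le> ?d \<gamma> U" for \<gamma> U by (intro config_avg_nonneg) simp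
  have dead: "?d \<gamma> U = 0" if "dfs_state a \<gamma> U W []" "b \<notin> W" for \<gamma> U W
  proof -
    have "\<not> linked (set \<gamma> \<union> X) a b" if "X \<subseteq> U" for X
      using dfs_state_attach[OF \<open>dfs_state a \<gamma> U W []\<close> \<open>b \<notin> W\<close> that] by auto
    then show ?thesis by (simp add: config_avg_def)
  qed
  have splits_b: "splits (\<lambda>X. linked X a c) (\<lambda>X. linked X b c) \<gamma> X Y \<or>
      splits (\<lambda>X. linked X a c) (\<lambda>X. linked X b c) \<gamma> Y X"
    if "?hb \<gamma> U" "X \<subseteq> U" "Y \<subseteq> U" "?D (set \<gamma> \<union> X)" "?D (set \<gamma> \<union> Y)" for \<gamma> U X Y
    using first_reach_splits[OF that(1-3)] that(4,5) by blast
  have "(\<lambda>X. linked X c b) = (\<lambda>X. linked X b c)" by (auto simp: fun_eq_iff intro: linked_sym)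
  then have splits_c: "splits (\<lambda>X. linked X a b) (\<lambda>X. linked X b c) \<gamma> X Y \<or>
      splits (\<lambda>X. linked X a b) (\<lambda>X. linked X b c) \<gamma> Y X"
    if "?hc \<gamma> U" "X \<subseteq> U" "Y \<subseteq> U" "?D (set \<gamma> \<union> X)" "?D (set \<gamma> \<union> Y)" for \<gamma> U X Y
    using first_reach_splits[OF that(1-3)] that(4,5) by simp
  have mono_or: "mono ?or"
  proof (intro monoI le_boolI)
    fix X Y :: "'v set set" assume "X \<subseteq> Y" "?or X"
    then show "?or Y" using linked_mono[of a b X Y] linked_mono[of a c X Y] by blast
  qed

  have b: "(avg ?hb)\<^sup>2 \<le> 2 * Pr (\<lambda>X. linked X a b) * (Pr (\<lambda>X. linked X a c) * Pr (\<lambda>X. linked X b c))"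
    unfolding avg_def Pr_def
    by (rule decision_tree_square[OF mono_linked mono_linked mono_linked assms(2) all_leaves_mono[OF leaves]])
      (intro impI conjI allI, erule first_reach_linked, rule splits_b)
  have c: "(avg ?hc)\<^sup>2 \<le> 2 * Pr (\<lambda>X. linked X a c) * (Pr (\<lambda>X. linked X a b) * Pr (\<lambda>X. linked X b c))"
    unfolding avg_def Pr_def
    by (rule decision_tree_square[OF mono_linked mono_linked mono_linked assms(2) all_leaves_mono[OF leaves]])
      (intro impI conjI allI, erule first_reach_linked, rule splits_c)
  have bc: "(avg (\<lambda>\<gamma> U. ?hb \<gamma> U \<or> ?hc \<gamma> U))\<^sup>2 \<le> 2 * Pr ?or * (Pr ?or * Pr (\<lambda>X. linked X b c))"
    unfolding avg_def Pr_def
  proof (rule decision_tree_square[OF mono_or mono_linked mono_or assms(2) all_leaves_mono[OF leaves]],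
      intro impI conjI allI)
    fix \<gamma> U assume h: "?hb \<gamma> U \<or> ?hc \<gamma> U"
    then show "linked (set \<gamma>) a b \<or> linked (set \<gamma>) a c" using first_reach_linked by metis
    fix X Y assume XY: "X \<subseteq> U" "Y \<subseteq> U" "?D (set \<gamma> \<union> X)" "?D (set \<gamma> \<union> Y)"
    from h show "splits ?or (\<lambda>X. linked X b c) \<gamma> X Y \<or> splits ?or (\<lambda>X. linked X b c) \<gamma> Y X"
    proof
      assume "?hb \<gamma> U"
      from splits_b[OF this XY] show ?thesis
        by (elim disjE)
          (rule disjI1, erule splits_weaken, simp, rule disjI2, erule splits_weaken, simp)
    next
      assume "?hc \<gamma> U"
      from splits_c[OF this XY] show ?thesis
        by (elim disjE)
          (rule disjI1, erule splits_weaken, simp, rule disjI2, erule splits_weaken, simp)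
    qed
  qed

  have Pr_nonneg: "0 \<le> Pr Q" for Q
    unfolding Pr_def by (intro config_avg_nonneg) simp
  have "Pr ?D \<le> avg (\<lambda>\<gamma> U. ?hb \<gamma> U \<or> ?hc \<gamma> U)"
    unfolding root avg_def
    by (rule leaf_avg_mono, rule all_leaves_mono[OF leaves]) (auto simp: dead)
  then have "(Pr ?D)\<^sup>2 \<le> (avg (\<lambda>\<gamma> U. ?hb \<gamma> U \<or> ?hc \<gamma> U))\<^sup>2"
    by (rule power_mono) (rule Pr_nonneg)
  with bc show ?thesis2 by (simp add: power2_eq_square mult_ac)

  have "Pr ?D \<le> avg ?hb + avg ?hc"
    unfolding root avg_def leaf_avg_add[symmetric]
    by (rule leaf_avg_mono, rule all_leaves_mono[OF leaves]) (use nonneg in \<open>auto simp: dead\<close>)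
  then have "(Pr ?D)\<^sup>2 \<le> (avg ?hb + avg ?hc)\<^sup>2"
    by (rule power_mono) (rule Pr_nonneg)
  also have "\<dots> \<le> 2 * (avg ?hb)\<^sup>2 + 2 * (avg ?hc)\<^sup>2"
    using sum_squares_bound[of "avg ?hb" "avg ?hc"] by (simp add: power2_sum)
  also have "\<dots> \<le> 8 * Pr (\<lambda>X. linked X a b) * Pr (\<lambda>X. linked X a c) * Pr (\<lambda>X. linked X b c)"
    using b c by (simp add: mult_ac)
  finally show ?thesis1 .
qed

section \<open>From finite graphs to the percolation measure\<close>

lemma prod_bernoulli_weights:
  fixes q :: "'e \<Rightarrow> bool pmf"
  assumes "finite F" "X \<subseteq> F"
  shows "(\<Prod>e\<in>F. pmf (q e) (e \<in> X)) = (\<Prod>e\<in>X. pmf (q e) True) * (\<Prod>e\<in>F - X. 1 - pmf (q e) True)"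
proof -
  have "(\<Prod>e\<in>F. pmf (q e) (e \<in> X)) = (\<Prod>e\<in>F - X. pmf (q e) (e \<in> X)) * (\<Prod>e\<in>X. pmf (q e) (e \<in> X))"
    by (rule prod.subset_diff[OF assms(2,1)])
  also have "(\<Prod>e\<in>F - X. pmf (q e) (e \<in> X)) = (\<Prod>e\<in>F - X. 1 - pmf (q e) True)"
    by (rule prod.cong) (simp_all add: pmf_False_conv_True[symmetric])
  also have "(\<Prod>e\<in>X. pmf (q e) (e \<in> X)) = (\<Prod>e\<in>X. pmf (q e) True)"
    by (rule prod.cong) simp_all
  finally show ?thesis by (simp only: mult.commute)
qed

text \<open>The event is a disjoint union of cylinders, one for each admissible set of open edges in \<open>F\<close>. The weight
of an edge is written as a mass of its Bernoulli distribution, so that it lies in the unit interval by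
construction.\<close>

lemma measure_percolation_finite:
  fixes p :: "'v set \<Rightarrow> real"
  assumes F: "finite F" "F \<subseteq> E"
  defines "M \<equiv> percolation E p"
  shows "{\<omega> \<in> space M. Q (open_edges F \<omega>)} \<in> sets M"
    and "measure M {\<omega> \<in> space M. Q (open_edges F \<omega>)} =
      config_avg (\<lambda>e. pmf (bernoulli_pmf (p e)) True) F (\<lambda>X. of_bool (Q X))"
proof -
  let ?b = "\<lambda>e. measure_pmf (bernoulli_pmf (p e))"
  interpret P: product_prob_space ?b E
    by (intro product_prob_spaceI prob_space_measure_pmf)
  define C where "C X = prod_emb E ?b F (\<Pi>\<^sub>E e\<in>F. {e \<in> X})" for X
  have M: "M = PiM E ?b" by (simp add: M_def percolation_def)
  have "C X = {\<omega> \<in> space M. \<forall>e\<in>F. \<omega> e = (e \<in> X)}" for X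
    by (auto simp: C_def M prod_emb_def space_PiM)
  moreover have "(\<forall>e\<in>F. \<omega> e = (e \<in> X)) \<longleftrightarrow> open_edges F \<omega> = X" if "X \<subseteq> F" for X \<omega>
    using that by (auto simp: open_edges_def)
  ultimately have C: "C X = {\<omega> \<in> space M. open_edges F \<omega> = X}" if "X \<subseteq> F" for X
    using that by simp
  have C_sets: "C X \<in> sets M" for X
    unfolding C_def M using F by (intro sets_PiM_I) auto
  have C_measure: "measure M (C X) =
      (\<Prod>e\<in>X. pmf (bernoulli_pmf (p e)) True) * (\<Prod>e\<in>F - X. 1 - pmf (bernoulli_pmf (p e)) True)"
    if "X \<subseteq> F" for X
  proof -
    have "measure M (C X) = (\<Prod>e\<in>F. measure (?b e) {e \<in> X})"
      unfolding C_def M using F by (intro P.measure_PiM_emb) auto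
    also have "\<dots> = (\<Prod>e\<in>F. pmf (bernoulli_pmf (p e)) (e \<in> X))"
      by (simp add: pmf.rep_eq)
    finally show ?thesis by (simp add: prod_bernoulli_weights[OF F(1) that])
  qed
  have "{\<omega> \<in> space M. Q (open_edges F \<omega>)} =
      (\<Union>X\<in>{X\<in>Pow F. Q X}. {\<omega> \<in> space M. open_edges F \<omega> = X})"
    by (auto simp: open_edges_def)
  then have eq: "{\<omega> \<in> space M. Q (open_edges F \<omega>)} = (\<Union>X\<in>{X\<in>Pow F. Q X}. C X)"
    using C by simp
  show "{\<omega> \<in> space M. Q (open_edges F \<omega>)} \<in> sets M"
    unfolding eq using C_sets F(1) by (intro sets.finite_UN) auto
  have "measure M {\<omega> \<in> space M. Q (open_edges F \<omega>)} = (\<Sum>X\<in>{X\<in>Pow F. Q X}. measure M (C X))"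
    unfolding eq
  proof (rule finite_measure.finite_measure_finite_Union)
    show "finite_measure M" unfolding M by (rule P.finite_measure_axioms)
    have "C X \<inter> C Y = {}" if "X \<subseteq> F" "Y \<subseteq> F" "X \<noteq> Y" for X Y
      unfolding C[OF that(1)] C[OF that(2)] using that(3) by blast
    then show "disjoint_family_on C {X \<in> Pow F. Q X}"
      by (simp add: disjoint_family_on_def)
  qed (use F(1) C_sets in auto)
  also have "\<dots> = (\<Sum>X\<in>Pow F. if Q X then measure M (C X) else 0)"
    using F(1) by (intro sum.inter_filter) simp
  also have "\<dots> = config_avg (\<lambda>e. pmf (bernoulli_pmf (p e)) True) F (\<lambda>X. of_bool (Q X))"
    unfolding config_avg_def by (rule sum.cong[OF refl]) (simp add: C_measure)
  finally show "measure M {\<omega> \<in> space M. Q (open_edges F \<omega>)} =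
      config_avg (\<lambda>e. pmf (bernoulli_pmf (p e)) True) F (\<lambda>X. of_bool (Q X))" .
qed

text \<open>Increasing events that are continuous along increasing sequences of configurations, as events about
finitely many connections are. Their probabilities are limits over an exhaustion of the graph.\<close>

definition finitary :: "('e set \<Rightarrow> bool) \<Rightarrow> bool" where
  "finitary Q \<longleftrightarrow> mono Q \<and> (\<forall>X. incseq X \<longrightarrow> Q (\<Union>n. X n) \<longrightarrow> (\<exists>n::nat. Q (X n)))"

lemma finitary_linked: "finitary (\<lambda>X. linked X u v)"
  unfolding finitary_def
proof (intro conjI allI impI mono_linked)
  fix X :: "nat \<Rightarrow> 'a set set" assume inc: "incseq X" and link: "linked (\<Union>n. X n) u v"
  from link show "\<exists>n. linked (X n) u v"
  proof (induction rule: rtrancl_induct)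
    case (step y z)
    obtain m where m: "linked (X m) u y" using step.IH ..
    obtain n where n: "{y, z} \<in> X n" using step.hyps by (auto simp: adj_def)
    have "linked (X (max m n)) u y"
      by (rule linked_mono[OF m incseqD[OF inc]]) simp
    moreover have "(y, z) \<in> adj (X (max m n))"
      using n incseqD[OF inc, of n "max m n"] by (auto simp: adj_def)
    ultimately show ?case by (blast intro: rtrancl_into_rtrancl)
  qed simp
qed

lemma finitary_conj:
  assumes "finitary P" "finitary Q"
  shows "finitary (\<lambda>X. P X \<and> Q X)"
  unfolding finitary_def
proof (intro conjI allI impI)
  have mono: "mono P" "mono Q" using assms by (auto simp: finitary_def)
  show "mono (\<lambda>X. P X \<and> Q X)" using monoD[OF mono(1)] monoD[OF mono(2)] by (intro monoI) auto
  fix X :: "nat \<Rightarrow> 'a set" assume inc: "incseq X" and PQ: "P (\<Union>n. X n) \<and> Q (\<Union>n. X n)"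
  obtain m n where "P (X m)" "Q (X n)" using assms inc PQ unfolding finitary_def by blast
  then show "\<exists>n. P (X n) \<and> Q (X n)"
    using monoD[OF mono(1) incseqD[OF inc], of m "max m n"] monoD[OF mono(2) incseqD[OF inc], of n "max m n"]
    by (intro exI[of _ "max m n"]) auto
qed

lemma finitary_disj:
  assumes "finitary P" "finitary Q"
  shows "finitary (\<lambda>X. P X \<or> Q X)"
  unfolding finitary_def
proof (intro conjI allI impI)
  have mono: "mono P" "mono Q" using assms by (auto simp: finitary_def)
  show "mono (\<lambda>X. P X \<or> Q X)" using monoD[OF mono(1)] monoD[OF mono(2)] by (intro monoI) auto
  fix X :: "nat \<Rightarrow> 'a set" assume "incseq X" "P (\<Union>n. X n) \<or> Q (\<Union>n. X n)"
  then show "\<exists>n. P (X n) \<or> Q (X n)" using assms unfolding finitary_def by metis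
qed

lemma finitary_measure_limit:
  assumes Q: "finitary Q" and F: "incseq F" "\<And>n. finite (F n)" "(\<Union>n. F n) = E"
  shows "(\<lambda>n. config_avg (\<lambda>e. pmf (bernoulli_pmf (p e)) True) (F n) (\<lambda>X. of_bool (Q X)))
    \<longlonglongrightarrow> measure (percolation E p) {\<omega> \<in> space (percolation E p). Q (open_edges E \<omega>)}"
proof -
  let ?M = "percolation E p"
  interpret prob_space ?M by (rule prob_space_percolation)
  let ?A = "\<lambda>n. {\<omega> \<in> space ?M. Q (open_edges (F n) \<omega>)}"
  have FE: "F n \<subseteq> E" for n using F(3) by auto
  have mono: "mono Q" using Q by (simp add: finitary_def)
  have inc: "incseq (\<lambda>n. open_edges (F n) \<omega>)" for \<omega>
    using F(1) by (auto simp: incseq_def open_edges_def)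
  have un: "(\<Union>n. open_edges (F n) \<omega>) = open_edges E \<omega>" for \<omega>
    using F(3) by (auto simp: open_edges_def)
  have "(\<lambda>n. measure ?M (?A n)) \<longlonglongrightarrow> measure ?M (\<Union>n. ?A n)"
  proof (rule finite_Lim_measure_incseq)
    show "range ?A \<subseteq> sets ?M" using measure_percolation_finite(1)[OF F(2) FE] by auto
    show "incseq ?A"
      using monoD[OF mono incseqD[OF inc]] by (auto simp: incseq_def)
  qed
  moreover have "(\<exists>n. Q (open_edges (F n) \<omega>)) \<longleftrightarrow> Q (open_edges E \<omega>)" for \<omega>
  proof
    assume "\<exists>n. Q (open_edges (F n) \<omega>)"
    then obtain n where "Q (open_edges (F n) \<omega>)" ..
    moreover have "open_edges (F n) \<omega> \<subseteq> open_edges E \<omega>" using un by blast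
    ultimately show "Q (open_edges E \<omega>)" using monoD[OF mono] by auto
  next
    assume "Q (open_edges E \<omega>)"
    then show "\<exists>n. Q (open_edges (F n) \<omega>)"
      using Q inc[of \<omega>] un[of \<omega>] unfolding finitary_def by metis
  qed
  then have "(\<Union>n. ?A n) = {\<omega> \<in> space ?M. Q (open_edges E \<omega>)}" by auto
  ultimately show ?thesis
    by (simp add: measure_percolation_finite(2)[OF F(2) FE])
qed

lemma countable_edges:
  assumes "simple_graph V E" "countable V"
  shows "countable E"
proof (rule countable_subset)
  show "E \<subseteq> {e. finite e \<and> e \<subseteq> V}"
    using assms(1) card.infinite by (fastforce simp: simple_graph_def)
  show "countable {e. finite e \<and> e \<subseteq> V}" using assms(2) by (rule countable_Collect_finite_subset)
qed

lemma countable_exhaustion: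
  assumes "countable E"
  obtains F :: "nat \<Rightarrow> 'e set" where "incseq F" "\<And>n. finite (F n)" "(\<Union>n. F n) = E"
proof
  let ?F = "\<lambda>n. {e \<in> E. to_nat_on E e < n}"
  show "incseq ?F" by (auto simp: incseq_def)
  show "finite (?F n)" for n
    by (rule inj_on_finite[of "to_nat_on E" _ "{..<n}"])
      (use inj_on_subset[OF inj_on_to_nat_on[OF assms]] in auto)
  show "(\<Union>n. ?F n) = E" by auto
qed

lemma same_cluster_eq_linked:
  assumes "u \<in> S" "S \<subseteq> V"
  shows "same_cluster V E p S =
    {\<omega> \<in> space (percolation E p). \<forall>x\<in>S. linked (open_edges E \<omega>) u x}"
  unfolding same_cluster_def clusters_def subset_component_iff[OF assms(1)]
  using assms by (auto simp: connection_def)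

theorem theorem6p2:
  fixes V :: "'v set" and E :: "'v set set" and p :: "'v set \<Rightarrow> real" and a b c :: 'v
  assumes "simple_graph V E" "locally_finite_graph V E" "connected_graph V E"
    and "\<forall>e\<in>E. 0 \<le> p e \<and> p e \<le> 1"
    and "a \<in> V" "b \<in> V" "c \<in> V" and "a \<noteq> b" "a \<noteq> c" "b \<noteq> c"
  shows "(measure (percolation E p) (same_cluster V E p {a, b, c}))\<^sup>2 \<le>
      8 * measure (percolation E p) (same_cluster V E p {a, b}) *
        measure (percolation E p) (same_cluster V E p {a, c}) *
        measure (percolation E p) (same_cluster V E p {b, c}) \<and>
    (measure (percolation E p) (same_cluster V E p {a, b, c}))\<^sup>2 \<le>
      2 * (measure (percolation E p) (same_cluster V E p {a, b} \<union> same_cluster V E p {a, c}))\<^sup>2 *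
        measure (percolation E p) (same_cluster V E p {b, c})"
proof -
  let ?M = "percolation E p"
  let ?ev = "\<lambda>Q. {\<omega> \<in> space ?M. Q (open_edges E \<omega>)}"
  let ?ab = "\<lambda>X. linked X a b" and ?ac = "\<lambda>X. linked X a c" and ?bc = "\<lambda>X. linked X b c"
  have pair: "same_cluster V E p {u, v} = ?ev (\<lambda>X. linked X u v)" if "u \<in> V" "v \<in> V" for u v
    using same_cluster_eq_linked[of u "{u, v}" V E p] that by simp
  have abc: "same_cluster V E p {a, b, c} = ?ev (\<lambda>X. ?ab X \<and> ?ac X)"
    using same_cluster_eq_linked[of a "{a, b, c}" V E p] assms(5-7) by simp
  have ab_ac: "same_cluster V E p {a, b} \<union> same_cluster V E p {a, c} = ?ev (\<lambda>X. ?ab X \<or> ?ac X)"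
    using pair assms(5-7) by auto

  obtain F :: "nat \<Rightarrow> 'v set set" where F: "incseq F" "\<And>n. finite (F n)" "(\<Union>n. F n) = E"
    using countable_exhaustion[OF countable_edges[OF assms(1) countable_vertices[OF assms(1-3)]]] by blast
  define q where "q e = pmf (bernoulli_pmf (p e)) True" for e
  define Pr where "Pr n Q = config_avg q (F n) (\<lambda>X. of_bool (Q X))" for n and Q :: "'v set set \<Rightarrow> bool"
  have lim: "(\<lambda>n. Pr n Q) \<longlonglongrightarrow> measure ?M (?ev Q)" if "finitary Q" for Q
    unfolding Pr_def q_def by (rule finitary_measure_limit[OF that F])
  have q: "edge_probabilities q" by unfold_locales (auto simp: q_def pmf_le_1)
  have card: "\<forall>e\<in>F n. card e = 2" for n
    using F(3) assms(1) unfolding simple_graph_def by blast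
  note finite_ineqs = finite_connection_inequalities[OF q F(2) card assms(8-10), folded Pr_def]
  note lim_ab = lim[OF finitary_linked[of a b]] and lim_ac = lim[OF finitary_linked[of a c]]
    and lim_bc = lim[OF finitary_linked[of b c]]
    and lim_abc = lim[OF finitary_conj[OF finitary_linked[of a b] finitary_linked[of a c]]]
    and lim_or = lim[OF finitary_disj[OF finitary_linked[of a b] finitary_linked[of a c]]]
  have "(measure ?M (?ev (\<lambda>X. ?ab X \<and> ?ac X)))\<^sup>2 \<le>
      8 * measure ?M (?ev ?ab) * measure ?M (?ev ?ac) * measure ?M (?ev ?bc)"
  proof (rule LIMSEQ_le)
    show "(\<lambda>n. (Pr n (\<lambda>X. ?ab X \<and> ?ac X))\<^sup>2) \<longlonglongrightarrow> (measure ?M (?ev (\<lambda>X. ?ab X \<and> ?ac X)))\<^sup>2"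
      by (intro tendsto_intros lim_abc)
    show "(\<lambda>n. 8 * Pr n ?ab * Pr n ?ac * Pr n ?bc) \<longlonglongrightarrow>
        8 * measure ?M (?ev ?ab) * measure ?M (?ev ?ac) * measure ?M (?ev ?bc)"
      by (intro tendsto_intros lim_ab lim_ac lim_bc)
  qed (intro exI allI impI finite_ineqs(1))
  moreover have "(measure ?M (?ev (\<lambda>X. ?ab X \<and> ?ac X)))\<^sup>2 \<le>
      2 * (measure ?M (?ev (\<lambda>X. ?ab X \<or> ?ac X)))\<^sup>2 * measure ?M (?ev ?bc)"
  proof (rule LIMSEQ_le)
    show "(\<lambda>n. (Pr n (\<lambda>X. ?ab X \<and> ?ac X))\<^sup>2) \<longlonglongrightarrow> (measure ?M (?ev (\<lambda>X. ?ab X \<and> ?ac X)))\<^sup>2"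
      by (intro tendsto_intros lim_abc)
    show "(\<lambda>n. 2 * (Pr n (\<lambda>X. ?ab X \<or> ?ac X))\<^sup>2 * Pr n ?bc) \<longlonglongrightarrow>
        2 * (measure ?M (?ev (\<lambda>X. ?ab X \<or> ?ac X)))\<^sup>2 * measure ?M (?ev ?bc)"
      by (intro tendsto_intros lim_or lim_bc)
  qed (intro exI allI impI finite_ineqs(2))
  ultimately show ?thesis
    unfolding abc ab_ac unfolding pair[OF assms(5,6)] pair[OF assms(5,7)] pair[OF assms(6,7)] ..
qed

end
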